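(* Let $Q$ be a commutative, semicartesian and geometric quantale. Then the sheaf $\Omega^-$ essentially classifies the dense subobjects in the category $Sh(Q)$. More precisely: 1. $\top:\mathbf 1\to\Omega^-$, given by $\top_u:\{*\}\to\Omega^-(u)$, $\top_u( * )=u^-$, determines a dense monomorphism in $Sh(Q)$. 2. For each dense monomorphism of sheaves $m:S\rightarrowtail F$, there is a unique morphism $\chi_m:F\to\Omega^-$ such that $\chi_m^-=\chi_m$ and such that the square with top $!_S:S\to\mathbf 1$, left side $m:S\rightarrowtail F$, bottom $\chi_m:F\to\Omega^-$ and right side $\top:\mathbf 1\to\Omega^-$ is a pullback. Moreover, for any morphisms $\phi,\phi':F\to\Omega^-$ that determine such pullback diagrams (i.e. with $\phi$, respectively $\phi'$, in place of $\chi_m$), it holds that $\phi^-=\phi'^-$.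
   Context: A quantale is a complete lattice $(Q,\le)$ with an associative binary operation $\odot$ satisfying $a\odot\bigvee_i b_i=\bigvee_i(a\odot b_i)$ and $(\bigvee_i b_i)\odot a=\bigvee_i(b_i\odot a)$ for all families. It is commutative if $\odot$ is; semicartesian if $a\odot b\le a$ and $a\odot b\le b$ for all $a,b$. $Idem(Q)=\{p\in Q:p\odot p=p\}$. For $q$ in a commutative semicartesian quantale, $q^-:=\bigvee\{p\in Idem(Q): p\le q\odot p\}$. $Q$ is geometric if $\bigvee_{i\in I}q_i^-=(\bigvee_{i\in I}q_i)^-$ for every family $\{q_i:i\in I\}\subseteq Q$. $Q$ is viewed as a poset category with a unique arrow $v\to u$ iff $v\le u$. A presheaf on $Q$ is a functor $F:Q^{op}\to Set$; for $v\le u$ the restriction map is denoted $F(v\le u):F(u)\to F(v)$, $s\mapsto s_{|_v}$. $F$ is a sheaf if for every $u\in Q$ and every family (possibly empty) with $u=\bigvee_{i\in I}u_i$, and every family $(s_i\in F(u_i))_{i\in I}$ with $s_{i|_{u_i\odot u_j}}=s_{j|_{u_i\odot u_j}}$ for all $i,j\in I$, there is a unique $s\in F(u)$ with $s_{|_{u_i}}=s_i$ for all $i$. $Sh(Q)$ is the category of sheaves on $Q$ and natural transformations; $\mathbf 1$ is its terminal object ($\mathbf 1(u)=\{*\}$ for all $u$), and $!_S$ is the unique morphism $S\to\mathbf 1$. $\Omega^-$ is the sheaf with $\Omega^-(u)=\{q\in Q: q\odot u^-=q\}$ and restriction maps $\Omega^-(u)\to\Omega^-(v)$, $q\mapsto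 q\odot v^-$, for $v\le u$. There is a natural transformation $(\ )^-:\Omega^-\to\Omega^-$ with components $q\mapsto q^-$; for $\phi:F\to\Omega^-$, $\phi^-:=(\ )^-\circ\phi$. A morphism of sheaves $\eta:G\to F$ is dense if for every $u\in Q$ and every $y\in F(u)$ there exists $m\in Q$ with $u^-\le m\le u$ such that: $F(m\le u)(y)\in\mathrm{range}(\eta_m)$ if and only if $y\in\mathrm{range}(\eta_u)$.
   Formalization: Dense is taken as: y is in range(η_u) if and only if there exists m with u⁻ ≤ m ≤ u and F(m≤u)(y) in range(η_m); with the whole equivalence under "there exists m", m = u makes every morphism dense and the theorem fails. *)

theory Defs
  imports Complex_Main "HOL-Library.FuncSet"
begin

section \<open>Quantales\<close>

class quantale = complete_lattice + semigroup_mult +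
  assumes mult_Sup: "a * Sup B = (SUP b\<in>B. a * b)"
    and Sup_mult: "Sup B * a = (SUP b\<in>B. b * a)"

class comm_semicartesian_quantale = quantale + ab_semigroup_mult +
  assumes mult_le_left: "a * b \<le> a"
    and mult_le_right: "a * b \<le> b"
begin

definition Idem :: "'a set" where
  "Idem = {p. p * p = p}"

definition qminus :: "'a \<Rightarrow> 'a"  ("(_\<^sup>-)" [1000] 999) where
  "q\<^sup>- = Sup {p \<in> Idem. p \<le> q * p}"

end

class geometric_quantale = comm_semicartesian_quantale +
  assumes Sup_qminus: "(SUP q\<in>A. q\<^sup>-) = (Sup A)\<^sup>-"


section \<open>Sheaves on a quantale\<close>

text \<open>
  \<open>res F u v\<close> is the restriction map from \<open>sec F u\<close> to \<open>sec F v\<close>. Only its values for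
  \<open>v \<le> u\<close> on \<open>sec F u\<close> matter.
\<close>

record ('q, 'a) presheaf =
  sec :: "'q \<Rightarrow> 'a set"
  res :: "'q \<Rightarrow> 'q \<Rightarrow> 'a \<Rightarrow> 'a"

definition is_presheaf :: "('q::order, 'a) presheaf \<Rightarrow> bool" where
  "is_presheaf F \<longleftrightarrow>
     (\<forall>u v. v \<le> u \<longrightarrow> res F u v \<in> sec F u \<rightarrow> sec F v) \<and>
     (\<forall>u. \<forall>s\<in>sec F u. res F u u s = s) \<and>
     (\<forall>u v w. w \<le> v \<longrightarrow> v \<le> u \<longrightarrow> (\<forall>s\<in>sec F u. res F v w (res F u v s) = res F u w s))"

text \<open>
  The members of a family of local sections may repeat an open with different sections, so
  covers are genuinely indexed families. Index sets are taken in \<open>'q \<times> 'a\<close>; by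
  \<open>sheaf_glue\<close> below this covers families indexed by arbitrary sets.
\<close>

definition sheaf :: "('q::comm_semicartesian_quantale, 'a) presheaf \<Rightarrow> bool" where
  "sheaf F \<longleftrightarrow> is_presheaf F \<and>
     (\<forall>u (I :: ('q \<times> 'a) set) U s.
        u = (SUP i\<in>I. U i) \<longrightarrow>
        (\<forall>i\<in>I. s i \<in> sec F (U i)) \<longrightarrow>
        (\<forall>i\<in>I. \<forall>j\<in>I. res F (U i) (U i * U j) (s i) = res F (U j) (U i * U j) (s j)) \<longrightarrow>
        (\<exists>!t. t \<in> sec F u \<and> (\<forall>i\<in>I. res F u (U i) t = s i)))"

lemma sheaf_glue:
  fixes F :: "('q::comm_semicartesian_quantale, 'a) presheaf" and I :: "'i set"
  assumes "sheaf F" and "u = (SUP i\<in>I. U i)" and "\<And>i. i \<in> I \<Longrightarrow> s i \<in> sec F (U i)"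
    and "\<And>i j. i \<in> I \<Longrightarrow> j \<in> I \<Longrightarrow>
      res F (U i) (U i * U j) (s i) = res F (U j) (U i * U j) (s j)"
  shows "\<exists>!t. t \<in> sec F u \<and> (\<forall>i\<in>I. res F u (U i) t = s i)"
proof -
  let ?J = "(\<lambda>i. (U i, s i)) ` I"
  have "\<exists>!t. t \<in> sec F u \<and> (\<forall>j\<in>?J. res F u (fst j) t = snd j)"
  proof (rule assms(1)[unfolded sheaf_def, THEN conjunct2, rule_format])
    show "u = (SUP j\<in>?J. fst j)" using assms(2) by (simp add: image_image)
  qed (use assms(3,4) in auto)
  then show ?thesis by simp
qed


section \<open>The category of sheaves\<close>

text \<open>
  Components of morphisms are extensional functions, so that equality of morphisms is
  equality in the logic.
\<close>

definition hom :: "('q::order, 'a) presheaf \<Rightarrow> ('q, 'b) presheaf \<Rightarrow> ('q \<Rightarrow> 'a \<Rightarrow> 'b) set" where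
  "hom F G = {\<eta>. (\<forall>u. \<eta> u \<in> sec F u \<rightarrow>\<^sub>E sec G u) \<and>
     (\<forall>u v. v \<le> u \<longrightarrow> (\<forall>s\<in>sec F u. res G u v (\<eta> u s) = \<eta> v (res F u v s)))}"

definition ncomp :: "('q, 'a) presheaf \<Rightarrow> ('q \<Rightarrow> 'b \<Rightarrow> 'c) \<Rightarrow> ('q \<Rightarrow> 'a \<Rightarrow> 'b) \<Rightarrow> ('q \<Rightarrow> 'a \<Rightarrow> 'c)"
  where "ncomp F \<theta> \<eta> = (\<lambda>u. compose (sec F u) (\<theta> u) (\<eta> u))"

text \<open>
  Universal properties quantify over test sheaves, whose sections need a type \<open>'t\<close>, which is
  passed as an argument. It does not matter which type is chosen, since representable
  sheaves, which exist over every \<open>'t\<close>, suffice as test objects: see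
  \<open>monic_test_type\<close> and \<open>pullback_test_type\<close> below.
\<close>

definition monic :: "'t itself \<Rightarrow> ('q::comm_semicartesian_quantale, 'a) presheaf \<Rightarrow>
    ('q, 'b) presheaf \<Rightarrow> ('q \<Rightarrow> 'a \<Rightarrow> 'b) \<Rightarrow> bool" where
  "monic (_ :: 't itself) S F m \<longleftrightarrow> sheaf S \<and> sheaf F \<and> m \<in> hom S F \<and>
     (\<forall>T :: ('q, 't) presheaf. sheaf T \<longrightarrow>
        (\<forall>g\<in>hom T S. \<forall>h\<in>hom T S. ncomp T m g = ncomp T m h \<longrightarrow> g = h))"

text \<open>The square has top \<open>q : P \<rightarrow> B\<close>, left side \<open>p : P \<rightarrow> A\<close>, bottom \<open>f : A \<rightarrow> C\<close> and right side
  \<open>g : B \<rightarrow> C\<close>.\<close>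

definition pullback :: "'t itself \<Rightarrow> ('q::comm_semicartesian_quantale, 'p) presheaf \<Rightarrow>
    ('q, 'a) presheaf \<Rightarrow> ('q, 'b) presheaf \<Rightarrow> ('q, 'c) presheaf \<Rightarrow>
    ('q \<Rightarrow> 'p \<Rightarrow> 'a) \<Rightarrow> ('q \<Rightarrow> 'p \<Rightarrow> 'b) \<Rightarrow> ('q \<Rightarrow> 'a \<Rightarrow> 'c) \<Rightarrow> ('q \<Rightarrow> 'b \<Rightarrow> 'c) \<Rightarrow> bool" where
  "pullback (_ :: 't itself) P A B C p q f g \<longleftrightarrow>
     sheaf P \<and> sheaf A \<and> sheaf B \<and> sheaf C \<and>
     p \<in> hom P A \<and> q \<in> hom P B \<and> f \<in> hom A C \<and> g \<in> hom B C \<and>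
     ncomp P f p = ncomp P g q \<and>
     (\<forall>T :: ('q, 't) presheaf. sheaf T \<longrightarrow>
        (\<forall>a\<in>hom T A. \<forall>b\<in>hom T B. ncomp T f a = ncomp T g b \<longrightarrow>
           (\<exists>!h. h \<in> hom T P \<and> ncomp T p h = a \<and> ncomp T q h = b)))"


subsection \<open>Independence of the type of test sections\<close>

definition yon :: "'q::order \<Rightarrow> ('q, 't) presheaf" where
  "yon u = \<lparr>sec = (\<lambda>v. if v \<le> u then {undefined} else {}), res = (\<lambda>_ _ _. undefined)\<rparr>"

definition yon_elt :: "('q::order, 'a) presheaf \<Rightarrow> 'q \<Rightarrow> 'a \<Rightarrow> ('q \<Rightarrow> 't \<Rightarrow> 'a)" where
  "yon_elt F u s = (\<lambda>v. \<lambda>_\<in>sec (yon u :: ('q, 't) presheaf) v. res F u v s)"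

lemma is_presheaf_yon: "is_presheaf (yon u)"
  by (auto simp: is_presheaf_def yon_def split: if_splits dest: order_trans)

lemma sheaf_yon: "sheaf (yon u)"
  unfolding sheaf_def
proof (intro conjI allI impI is_presheaf_yon)
  fix w and I :: "('a \<times> 'b) set" and U s
  assume w: "w = (SUP i\<in>I. U i)" and s: "\<forall>i\<in>I. s i \<in> sec (yon u) (U i)"
  have le: "U i \<le> u \<and> s i = undefined" if "i \<in> I" for i
    using s that by (auto simp: yon_def split: if_splits)
  then have "w \<le> u" unfolding w by (auto intro: SUP_least)
  then show "\<exists>!t. t \<in> sec (yon u) w \<and> (\<forall>i\<in>I. res (yon u) w (U i) t = s i)"
    using le by (auto simp: yon_def)
qed

lemma is_presheaf_res: "is_presheaf F \<Longrightarrow> s \<in> sec F u \<Longrightarrow> v \<le> u \<Longrightarrow> res F u v s \<in> sec F v"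
  by (auto simp: is_presheaf_def)

lemma is_presheaf_res_id: "is_presheaf F \<Longrightarrow> s \<in> sec F u \<Longrightarrow> res F u u s = s"
  by (auto simp: is_presheaf_def)

lemma is_presheaf_res_res:
  "is_presheaf F \<Longrightarrow> s \<in> sec F u \<Longrightarrow> v \<le> u \<Longrightarrow> w \<le> v \<Longrightarrow> res F v w (res F u v s) = res F u w s"
  by (auto simp: is_presheaf_def)

lemma hom_closed: "\<eta> \<in> hom F G \<Longrightarrow> s \<in> sec F u \<Longrightarrow> \<eta> u s \<in> sec G u"
  unfolding hom_def by auto

lemma hom_natural:
  "\<eta> \<in> hom F G \<Longrightarrow> s \<in> sec F u \<Longrightarrow> v \<le> u \<Longrightarrow> res G u v (\<eta> u s) = \<eta> v (res F u v s)"
  unfolding hom_def by auto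

lemma hom_eqI:
  assumes "\<eta> \<in> hom F G" "\<theta> \<in> hom F H" "\<And>u s. s \<in> sec F u \<Longrightarrow> \<eta> u s = \<theta> u s"
  shows "\<eta> = \<theta>"
proof
  fix u
  have "\<eta> u \<in> extensional (sec F u)" "\<theta> u \<in> extensional (sec F u)"
    using assms(1,2) by (auto simp: hom_def PiE_def)
  then show "\<eta> u = \<theta> u" using assms(3) by (rule extensionalityI)
qed

lemma hom_ncomp: "\<eta> \<in> hom F G \<Longrightarrow> \<theta> \<in> hom G H \<Longrightarrow> is_presheaf F \<Longrightarrow> ncomp F \<theta> \<eta> \<in> hom F H"
  by (auto simp: hom_def ncomp_def compose_def is_presheaf_def Pi_iff PiE_iff)

lemma ncomp_apply: "s \<in> sec F u \<Longrightarrow> ncomp F \<theta> \<eta> u s = \<theta> u (\<eta> u s)"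
  by (simp add: ncomp_def compose_def)

lemma yon_elt_hom: "is_presheaf F \<Longrightarrow> s \<in> sec F u \<Longrightarrow> yon_elt F u s \<in> hom (yon u) F"
  by (auto simp: hom_def yon_elt_def yon_def is_presheaf_res is_presheaf_res_res
      dest: order_trans)

lemma yon_elt_top: "is_presheaf F \<Longrightarrow> s \<in> sec F u \<Longrightarrow> yon_elt F u s u undefined = s"
  by (simp add: yon_elt_def yon_def is_presheaf_res_id)

lemma yon_hom_eq:
  assumes "is_presheaf F" "h \<in> hom (yon u) F"
  shows "h = yon_elt F u (h u undefined)" and "h u undefined \<in> sec F u"
proof -
  show 1: "h u undefined \<in> sec F u" using assms(2) by (rule hom_closed) (simp add: yon_def)
  show "h = yon_elt F u (h u undefined)"
  proof (rule hom_eqI[OF assms(2) yon_elt_hom[OF assms(1) 1]])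
    fix v s assume "s \<in> sec (yon u :: ('a, 'c) presheaf) v"
    then have "v \<le> u" "s = undefined" by (auto simp: yon_def split: if_splits)
    then show "h v s = yon_elt F u (h u undefined) v s"
      using hom_natural[OF assms(2), of undefined u v] by (simp add: yon_elt_def yon_def)
  qed
qed

lemma ncomp_yon_elt:
  assumes "is_presheaf F" "is_presheaf G" "m \<in> hom F G" "s \<in> sec F u"
  shows "ncomp (yon u) m (yon_elt F u s) = yon_elt G u (m u s)"
proof (rule hom_eqI)
  show "ncomp (yon u) m (yon_elt F u s) \<in> hom (yon u) G"
    by (rule hom_ncomp[OF yon_elt_hom[OF assms(1,4)] assms(3) is_presheaf_yon])
  show "yon_elt G u (m u s) \<in> hom (yon u) G"
    by (rule yon_elt_hom[OF assms(2) hom_closed[OF assms(3,4)]])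
  fix v and t :: 'd assume t: "t \<in> sec (yon u) v"
  then have "v \<le> u" by (auto simp: yon_def split: if_splits)
  then show "ncomp (yon u) m (yon_elt F u s) v t = yon_elt G u (m u s) v t"
    using t hom_natural[OF assms(3,4)] by (simp add: ncomp_apply yon_elt_def)
qed

lemma monic_iff_inj:
  "monic TYPE('t) S F m \<longleftrightarrow> sheaf S \<and> sheaf F \<and> m \<in> hom S F \<and> (\<forall>u. inj_on (m u) (sec S u))"
proof (intro iffI; (elim conjE)?)
  assume M: "monic TYPE('t) S F m"
  then have pre: "sheaf S" "sheaf F" "is_presheaf S" "is_presheaf F" and m: "m \<in> hom S F"
    by (auto simp: monic_def sheaf_def)
  have "s = t" if "s \<in> sec S u" "t \<in> sec S u" "m u s = m u t" for u s t
  proof -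
    let ?s = "yon_elt S u s :: _ \<Rightarrow> 't \<Rightarrow> _" and ?t = "yon_elt S u t :: _ \<Rightarrow> 't \<Rightarrow> _"
    have "ncomp (yon u) m ?s = ncomp (yon u) m ?t"
      using that pre m by (simp add: ncomp_yon_elt)
    moreover have "sheaf (yon u :: (_, 't) presheaf)" by (rule sheaf_yon)
    moreover have "?s \<in> hom (yon u) S" "?t \<in> hom (yon u) S"
      using that pre by (simp_all add: yon_elt_hom)
    ultimately have "?s = ?t" using M unfolding monic_def by blast
    then show "s = t"
      using yon_elt_top[OF pre(3) that(1)] yon_elt_top[OF pre(3) that(2)] by metis
  qed
  then show "sheaf S \<and> sheaf F \<and> m \<in> hom S F \<and> (\<forall>u. inj_on (m u) (sec S u))"
    using pre m by (auto simp: inj_on_def)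
next
  assume S: "sheaf S" "sheaf F" "m \<in> hom S F" and inj: "\<forall>u. inj_on (m u) (sec S u)"
  have "g = h" if "g \<in> hom T S" "h \<in> hom T S" "ncomp T m g = ncomp T m h"
    for T :: "('a, 't) presheaf" and g h
  proof (rule hom_eqI[OF that(1,2)])
    fix u s assume s: "s \<in> sec T u"
    then have "m u (g u s) = m u (h u s)"
      using ncomp_apply[OF s, of m g] ncomp_apply[OF s, of m h] that(3) by simp
    then show "g u s = h u s"
      using inj hom_closed[OF that(1) s] hom_closed[OF that(2) s] by (auto dest: inj_onD)
  qed
  then show "monic TYPE('t) S F m" using S by (auto simp: monic_def)
qed

lemma monic_test_type: "monic TYPE('t) S F m \<longleftrightarrow> monic TYPE('t2) S F m"
  by (simp add: monic_iff_inj)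

lemma ex1_uniq: "\<exists>!x. P x \<Longrightarrow> P x \<Longrightarrow> P y \<Longrightarrow> x = y"
  by blast

lemma pullback_iff_pointwise:
  "pullback TYPE('t) P A B C p q f g \<longleftrightarrow>
     sheaf P \<and> sheaf A \<and> sheaf B \<and> sheaf C \<and>
     p \<in> hom P A \<and> q \<in> hom P B \<and> f \<in> hom A C \<and> g \<in> hom B C \<and>
     ncomp P f p = ncomp P g q \<and>
     (\<forall>u. \<forall>y\<in>sec A u. \<forall>z\<in>sec B u. f u y = g u z \<longrightarrow>
        (\<exists>!s. s \<in> sec P u \<and> p u s = y \<and> q u s = z))"
  (is "?L \<longleftrightarrow> ?R")
proof
  assume L: ?L
  then have sh: "is_presheaf P" "is_presheaf A" "is_presheaf B" "is_presheaf C"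
    and hs: "p \<in> hom P A" "q \<in> hom P B" "f \<in> hom A C" "g \<in> hom B C"
    by (auto simp: pullback_def sheaf_def)
  have "\<exists>!s. s \<in> sec P u \<and> p u s = y \<and> q u s = z"
    if y: "y \<in> sec A u" and z: "z \<in> sec B u" and e: "f u y = g u z" for u y z
  proof -
    let ?y = "yon_elt A u y :: _ \<Rightarrow> 't \<Rightarrow> _" and ?z = "yon_elt B u z :: _ \<Rightarrow> 't \<Rightarrow> _"
    have "ncomp (yon u) f ?y = ncomp (yon u) g ?z"
      using sh hs y z e by (simp add: ncomp_yon_elt)
    moreover have "sheaf (yon u :: (_, 't) presheaf)" by (rule sheaf_yon)
    moreover have "?y \<in> hom (yon u) A" "?z \<in> hom (yon u) B"
      using sh y z by (simp_all add: yon_elt_hom)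
    ultimately have ex1: "\<exists>!h. h \<in> hom (yon u) P \<and> ncomp (yon u) p h = ?y \<and> ncomp (yon u) q h = ?z"
      using L unfolding pullback_def by blast
    have iff: "p u s = y \<and> q u s = z \<longleftrightarrow>
        ncomp (yon u) p (yon_elt P u s) = ?y \<and> ncomp (yon u) q (yon_elt P u s) = ?z"
      if s: "s \<in> sec P u" for s
    proof -
      have "p u s = y \<longleftrightarrow> yon_elt A u (p u s) = ?y"
        using yon_elt_top[OF sh(2) hom_closed[OF hs(1) s]] yon_elt_top[OF sh(2) y] by metis
      moreover have "q u s = z \<longleftrightarrow> yon_elt B u (q u s) = ?z"
        using yon_elt_top[OF sh(3) hom_closed[OF hs(2) s]] yon_elt_top[OF sh(3) z] by metis
      ultimately show ?thesis using sh hs s by (simp add: ncomp_yon_elt)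
    qed
    obtain h where h: "h \<in> hom (yon u) P" "ncomp (yon u) p h = ?y" "ncomp (yon u) q h = ?z"
      using ex1 by blast
    show ?thesis
    proof (rule ex1I[of _ "h u undefined"])
      show "h u undefined \<in> sec P u \<and> p u (h u undefined) = y \<and> q u (h u undefined) = z"
        using iff[OF yon_hom_eq(2)[OF sh(1) h(1)]] h(2,3)
        by (simp flip: yon_hom_eq(1)[OF sh(1) h(1)] add: yon_hom_eq(2)[OF sh(1) h(1)])
      fix s assume s: "s \<in> sec P u \<and> p u s = y \<and> q u s = z"
      then have "yon_elt P u s = h"
        using iff[of s] yon_elt_hom[OF sh(1), of s u] h by (intro ex1_uniq[OF ex1]) auto
      then show "s = h u undefined" using yon_elt_top[OF sh(1) conjunct1[OF s]] by metis
    qed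
  qed
  then show ?R using L by (auto simp: pullback_def)
next
  assume R: ?R
  then have sh: "is_presheaf P" "is_presheaf A" "is_presheaf B" "is_presheaf C"
    and hs: "p \<in> hom P A" "q \<in> hom P B" "f \<in> hom A C" "g \<in> hom B C"
    by (auto simp: sheaf_def)
  have pt: "\<exists>!s. s \<in> sec P u \<and> p u s = y \<and> q u s = z"
    if "y \<in> sec A u" "z \<in> sec B u" "f u y = g u z" for u y z
    using R that by blast
  have "\<exists>!h. h \<in> hom T P \<and> ncomp T p h = a \<and> ncomp T q h = b"
    if T: "sheaf T" and a: "a \<in> hom T A" and b: "b \<in> hom T B"
      and e: "ncomp T f a = ncomp T g b"
    for T :: "('a, 't) presheaf" and a b
  proof -
    have T': "is_presheaf T" using T by (simp add: sheaf_def)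
    define h where "h = (\<lambda>u. \<lambda>x\<in>sec T u. THE s. s \<in> sec P u \<and> p u s = a u x \<and> q u s = b u x)"
    have ex1: "\<exists>!s. s \<in> sec P u \<and> p u s = a u x \<and> q u s = b u x" if "x \<in> sec T u" for u x
    proof (rule pt[OF hom_closed[OF a that] hom_closed[OF b that]])
      show "f u (a u x) = g u (b u x)"
        using e ncomp_apply[OF that, of f a] ncomp_apply[OF that, of g b] by simp
    qed
    have hx: "h u x \<in> sec P u" "p u (h u x) = a u x" "q u (h u x) = b u x"
      if "x \<in> sec T u" for u x
      using theI'[OF ex1[OF that]] that by (simp_all add: h_def)
    have h_hom: "h \<in> hom T P"
      unfolding hom_def
    proof (intro CollectI conjI allI impI ballI)
      show "h u \<in> sec T u \<rightarrow>\<^sub>E sec P u" for u using hx(1) by (auto simp: h_def)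
      fix u v x assume v: "v \<le> u" and x: "x \<in> sec T u"
      have x': "res T u v x \<in> sec T v" using T' x v by (rule is_presheaf_res)
      have "p v (res P u v (h u x)) = a v (res T u v x)"
        using hom_natural[OF hs(1) hx(1)[OF x] v] hom_natural[OF a x v] hx(2)[OF x] by simp
      moreover have "q v (res P u v (h u x)) = b v (res T u v x)"
        using hom_natural[OF hs(2) hx(1)[OF x] v] hom_natural[OF b x v] hx(3)[OF x] by simp
      ultimately show "res P u v (h u x) = h v (res T u v x)"
        using hx[OF x'] is_presheaf_res[OF sh(1) hx(1)[OF x] v]
        by (intro ex1_uniq[OF ex1[OF x']]) simp_all
    qed
    show ?thesis
    proof (rule ex1I[of _ h], intro conjI)
      show "ncomp T p h = a"
        by (rule hom_eqI[OF hom_ncomp[OF h_hom hs(1) T'] a]) (simp add: ncomp_apply hx)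
      show "ncomp T q h = b"
        by (rule hom_eqI[OF hom_ncomp[OF h_hom hs(2) T'] b]) (simp add: ncomp_apply hx)
    next
      fix k assume k: "k \<in> hom T P \<and> ncomp T p k = a \<and> ncomp T q k = b"
      show "k = h"
      proof (rule hom_eqI[OF conjunct1[OF k] h_hom])
        fix u x assume x: "x \<in> sec T u"
        have "p u (k u x) = a u x" "q u (k u x) = b u x"
          using k ncomp_apply[OF x, of p k] ncomp_apply[OF x, of q k] by simp_all
        then show "k u x = h u x"
          using hx[OF x] hom_closed[OF conjunct1[OF k] x] by (intro ex1_uniq[OF ex1[OF x]]) simp_all
      qed
    qed (rule h_hom)
  qed
  then show ?L using R by (simp add: pullback_def)
qed

lemma pullback_test_type:
  "pullback TYPE('t) P A B C p q f g \<longleftrightarrow> pullback TYPE('t2) P A B C p q f g"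
  by (simp add: pullback_iff_pointwise)


section \<open>Dense morphisms and the object \<open>\<Omega>\<^sup>-\<close>\<close>

text \<open>
  The existential quantifier over \<open>m\<close> is confined to the left-hand side of the equivalence.
  With the whole equivalence in its scope, \<open>m = u\<close> would make every morphism dense.
\<close>

definition dense :: "('q::comm_semicartesian_quantale, 'a) presheaf \<Rightarrow> ('q, 'b) presheaf \<Rightarrow>
    ('q \<Rightarrow> 'a \<Rightarrow> 'b) \<Rightarrow> bool" where
  "dense G F \<eta> \<longleftrightarrow> \<eta> \<in> hom G F \<and>
     (\<forall>u. \<forall>y\<in>sec F u.
        (\<exists>m. u\<^sup>- \<le> m \<and> m \<le> u \<and> res F u m y \<in> \<eta> m ` sec G m) \<longleftrightarrow> y \<in> \<eta> u ` sec G u)"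

definition One :: "('q, unit) presheaf" where
  "One = \<lparr>sec = (\<lambda>_. {()}), res = (\<lambda>_ _ _. ())\<rparr>"

definition bang :: "('q, 'a) presheaf \<Rightarrow> 'q \<Rightarrow> 'a \<Rightarrow> unit" where
  "bang S = (\<lambda>u. \<lambda>_\<in>sec S u. ())"

definition Omega :: "('q::comm_semicartesian_quantale, 'q) presheaf" where
  "Omega = \<lparr>sec = (\<lambda>u. {q. q * u\<^sup>- = q}), res = (\<lambda>u v q. q * v\<^sup>-)\<rparr>"

definition truth :: "'q::comm_semicartesian_quantale \<Rightarrow> unit \<Rightarrow> 'q" where
  "truth = (\<lambda>u _. u\<^sup>-)"

definition Omega_minus :: "'q::comm_semicartesian_quantale \<Rightarrow> 'q \<Rightarrow> 'q" where
  "Omega_minus = (\<lambda>u. \<lambda>q\<in>sec Omega u. q\<^sup>-)"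

definition nminus :: "('q::comm_semicartesian_quantale, 'a) presheaf \<Rightarrow> ('q \<Rightarrow> 'a \<Rightarrow> 'q) \<Rightarrow>
    ('q \<Rightarrow> 'a \<Rightarrow> 'q)" where
  "nminus F \<phi> = ncomp F Omega_minus \<phi>"

end

theory Submission
  imports Defs
begin

text \<open>
  Since \<open>q\<^sup>-\<close> is the largest idempotent below \<open>q\<close>, it satisfies
  \<open>(a * b)\<^sup>- = a\<^sup>- * b\<^sup>-\<close>. A section \<open>y\<close> of \<open>F\<close> over \<open>u\<close> is classified by the join of all \<open>v\<^sup>-\<close>
  with \<open>v \<le> u\<close> such that \<open>y\<close> restricted to \<open>v\<close> lies in \<open>S\<close>. If this join is \<open>u\<^sup>-\<close>, then the
  restrictions to these \<open>v\<^sup>-\<close> glue, so that \<open>y\<close> restricted to \<open>u\<^sup>-\<close> lies in \<open>S\<close>, and density lifts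
  this to \<open>y\<close> itself. If \<open>\<phi>\<close> is any morphism with the pullback property, then \<open>y\<close> restricted to
  \<open>v \<le> u\<close> lies in \<open>S\<close> exactly when \<open>v\<^sup>- \<le> \<phi>\<^sub>u(y)\<close>, and the join of these \<open>v\<^sup>-\<close> is \<open>\<phi>\<^sub>u(y)\<^sup>-\<close>.
\<close>

section \<open>The largest idempotent below an element\<close>

text \<open>Distributivity over the two-element join \<open>Sup {y, z}\<close> with
  \<open>y \<le> z\<close> gives monotonicity in the right factor; commutativity transfers it to the
  left one.\<close>

lemma mult_mono_quantale:
  fixes a b c d :: "'q::comm_semicartesian_quantale"
  assumes "a \<le> b" and "c \<le> d"
  shows "a * c \<le> b * d"
proof -
  have right: "x * y \<le> x * z" if "y \<le> z" for x y z :: 'q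
  proof -
    have "x * y \<le> (SUP b\<in>{y, z}. x * b)" by simp
    also have "\<dots> = x * Sup {y, z}" by (rule mult_Sup[symmetric])
    also have "Sup {y, z} = z" using that by (simp add: sup.absorb2)
    finally show ?thesis .
  qed
  have "a * c \<le> a * d" using assms(2) by (rule right)
  also have "\<dots> = d * a" by (rule mult.commute)
  also have "\<dots> \<le> d * b" using assms(1) by (rule right)
  finally show ?thesis by (simp add: mult.commute)
qed

text \<open>Identifies the join defining \<open>q\<^sup>-\<close> with the join of all idempotents
  below \<open>q\<close>: if \<open>p \<le> q\<close>, then
  \<open>p = p * p \<le> q * p\<close>.\<close>

lemma le_mult_Idem_iff:
  fixes p q :: "'q::comm_semicartesian_quantale"
  assumes "p \<in> Idem"
  shows "p \<le> q * p \<longleftrightarrow> p \<le> q"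
proof
  show "p \<le> q" if "p \<le> q * p" using that mult_le_left order_trans by blast
  show "p \<le> q * p" if "p \<le> q"
    using mult_mono_quantale[OF that order_refl, of p] assms by (simp add: Idem_def)
qed

lemma mult_Idem_eq_iff:
  fixes p q :: "'q::comm_semicartesian_quantale"
  assumes "p \<in> Idem"
  shows "q * p = p \<longleftrightarrow> p \<le> q"
  using le_mult_Idem_iff[OF assms, of q] mult_le_right[of q p] by auto

text \<open>Each \<open>p = p * p\<close> in \<open>A\<close> lies below
  \<open>Sup A * Sup A\<close>. Hence \<open>q\<^sup>-\<close>, a join of idempotents, is idempotent
  itself.\<close>

lemma Sup_Idem:
  fixes A :: "'q::comm_semicartesian_quantale set"
  assumes "A \<subseteq> Idem"
  shows "Sup A \<in> Idem"
proof -
  have "Sup A \<le> Sup A * Sup A"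
  proof (rule Sup_least)
    fix p assume p: "p \<in> A"
    then have "p = p * p" using assms by (auto simp: Idem_def)
    also have "\<dots> \<le> Sup A * Sup A" by (intro mult_mono_quantale Sup_upper p)
    finally show "p \<le> Sup A * Sup A" .
  qed
  then show ?thesis using mult_le_left[of "Sup A" "Sup A"] by (simp add: Idem_def)
qed

lemma mult_Idem:
  fixes p q :: "'q::comm_semicartesian_quantale"
  shows "p \<in> Idem \<Longrightarrow> q \<in> Idem \<Longrightarrow> p * q \<in> Idem"
  by (simp add: Idem_def) (metis mult.assoc mult.commute)

lemma qminus_eq_Sup_Idem: "q\<^sup>- = Sup {p \<in> Idem. p \<le> q}"
  for q :: "'q::comm_semicartesian_quantale"
  by (simp add: qminus_def le_mult_Idem_iff cong: conj_cong)

lemma qminus_Idem: "q\<^sup>- \<in> Idem" for q :: "'q::comm_semicartesian_quantale"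
  unfolding qminus_eq_Sup_Idem by (rule Sup_Idem) auto

lemma qminus_le: "q\<^sup>- \<le> q" for q :: "'q::comm_semicartesian_quantale"
  unfolding qminus_eq_Sup_Idem by (auto intro: Sup_least)

lemma Idem_le_qminus_iff:
  fixes p q :: "'q::comm_semicartesian_quantale"
  shows "p \<in> Idem \<Longrightarrow> p \<le> q\<^sup>- \<longleftrightarrow> p \<le> q"
  using qminus_le[of q] by (auto simp: qminus_eq_Sup_Idem intro: Sup_upper order_trans)

lemma qminus_of_Idem:
  fixes p :: "'q::comm_semicartesian_quantale"
  shows "p \<in> Idem \<Longrightarrow> p\<^sup>- = p"
  by (simp add: Idem_le_qminus_iff order.antisym qminus_le)

lemma qminus_mono:
  fixes u v :: "'q::comm_semicartesian_quantale"
  shows "v \<le> u \<Longrightarrow> v\<^sup>- \<le> u\<^sup>-"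
  using Idem_le_qminus_iff qminus_Idem qminus_le order_trans by blast

lemma qminus_absorb:
  fixes u v :: "'q::comm_semicartesian_quantale"
  assumes "v \<le> u"
  shows "u\<^sup>- * v\<^sup>- = v\<^sup>-"
  using mult_Idem_eq_iff qminus_Idem qminus_mono[OF assms] by blast

text \<open>The right-hand side is an idempotent below \<open>u * v\<close>; the left-hand side
  equals its own square and lies below both \<open>u\<^sup>-\<close> and \<open>v\<^sup>-\<close>.
  This describes restriction in \<open>Omega\<close> to the overlap of two opens.\<close>

lemma qminus_mult: "(u * v)\<^sup>- = u\<^sup>- * v\<^sup>-"
  for u v :: "'q::comm_semicartesian_quantale"
proof (rule order.antisym)
  have "(u * v)\<^sup>- = (u * v)\<^sup>- * (u * v)\<^sup>-" using qminus_Idem[of "u * v"] by (simp add: Idem_def)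
  also have "\<dots> \<le> u\<^sup>- * v\<^sup>-"
    by (intro mult_mono_quantale qminus_mono mult_le_left mult_le_right)
  finally show "(u * v)\<^sup>- \<le> u\<^sup>- * v\<^sup>-" .
  show "u\<^sup>- * v\<^sup>- \<le> (u * v)\<^sup>-"
    by (simp add: Idem_le_qminus_iff mult_Idem qminus_Idem mult_mono_quantale qminus_le)
qed


section \<open>The sheaves \<open>1\<close> and \<open>\<Omega>\<^sup>-\<close>\<close>

lemma sheaf_One: "sheaf One"
  by (auto simp: sheaf_def is_presheaf_def One_def)

lemma sec_Omega: "q \<in> sec Omega u \<longleftrightarrow> q * u\<^sup>- = q"
  by (simp add: Omega_def)

lemma res_Omega: "res Omega u v q = q * v\<^sup>-"
  by (simp add: Omega_def)

lemma is_presheaf_Omega: "is_presheaf Omega"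
  unfolding is_presheaf_def
proof (intro conjI allI impI ballI)
  show "res Omega u v \<in> sec Omega u \<rightarrow> sec Omega v" if "v \<le> u" for u v :: 'a
    using qminus_absorb[of v v] by (auto simp: sec_Omega res_Omega mult.assoc)
qed (simp_all add: sec_Omega res_Omega mult.assoc qminus_absorb)

text \<open>Compatible sections glue to their join.\<close>

lemma sheaf_Omega: "sheaf (Omega :: ('q::geometric_quantale, 'q) presheaf)"
  unfolding sheaf_def
proof (intro conjI allI impI is_presheaf_Omega)
  fix u :: 'q and I :: "('q \<times> 'q) set" and U s
  assume u: "u = (SUP i\<in>I. U i)" and "\<forall>i\<in>I. s i \<in> sec Omega (U i)"
    and "\<forall>i\<in>I. \<forall>j\<in>I. res Omega (U i) (U i * U j) (s i) = res Omega (U j) (U i * U j) (s j)"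
  then have s: "s i * (U i)\<^sup>- = s i"
    and compat: "s i * ((U i)\<^sup>- * (U j)\<^sup>-) = s j * ((U i)\<^sup>- * (U j)\<^sup>-)"
    if "i \<in> I" "j \<in> I" for i j
    using that by (auto simp: sec_Omega res_Omega qminus_mult)
  have le: "U i \<le> u" if "i \<in> I" for i using that unfolding u by (rule SUP_upper)
  \<comment> \<open>Geometricity enters here: \<open>u\<^sup>-\<close> is the join of the
    \<open>(U i)\<^sup>-\<close>, so a section over \<open>u\<close> is the join of its
    restrictions.\<close>
  have mult_u: "q * u\<^sup>- = (SUP i\<in>I. q * (U i)\<^sup>-)" for q
    using Sup_qminus[of "U ` I", symmetric] by (simp add: u image_image mult_Sup)
  have s_u: "s i * u\<^sup>- = s i" if "i \<in> I" for i
    using s[OF that that] qminus_absorb[OF le[OF that]] by (metis mult.assoc mult.commute)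
  let ?t = "SUP i\<in>I. s i"
  show "\<exists>!t. t \<in> sec Omega u \<and> (\<forall>i\<in>I. res Omega u (U i) t = s i)"
  proof (rule ex1I[of _ ?t], intro conjI ballI)
    show "?t \<in> sec Omega u" by (simp add: sec_Omega Sup_mult image_image s_u)
    fix j assume j: "j \<in> I"
    \<comment> \<open>Swapping the indices turns the join of the \<open>s i * (U j)\<^sup>-\<close>
      over \<open>i\<close> into \<open>s j * u\<^sup>-\<close>, which is
      \<open>s j\<close>.\<close>
    have "s i * (U j)\<^sup>- = s j * (U i)\<^sup>-" if i: "i \<in> I" for i
    proof -
      have "s i * (U j)\<^sup>- = s i * ((U i)\<^sup>- * (U j)\<^sup>-)" using s[OF i i] by (simp flip: mult.assoc)
      also have "\<dots> = s j * ((U j)\<^sup>- * (U i)\<^sup>-)" using compat[OF i j] by (simp add: mult.commute)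
      also have "\<dots> = s j * (U i)\<^sup>-" using s[OF j j] by (simp flip: mult.assoc)
      finally show ?thesis .
    qed
    then have "?t * (U j)\<^sup>- = s j * u\<^sup>-" by (simp add: Sup_mult mult_u image_image)
    then show "res Omega u (U j) ?t = s j" by (simp add: res_Omega s_u j)
  next
    fix t assume t: "t \<in> sec Omega u \<and> (\<forall>i\<in>I. res Omega u (U i) t = s i)"
    then have "t = t * u\<^sup>-" by (simp add: sec_Omega)
    also have "\<dots> = ?t" using t by (simp add: mult_u res_Omega)
    finally show "t = ?t" .
  qed
qed

lemma truth_hom: "truth \<in> hom One Omega"
  by (auto simp: hom_def truth_def One_def sec_Omega res_Omega qminus_absorb)

lemma monic_truth: "monic TYPE('t) (One :: ('q::geometric_quantale, unit) presheaf) Omega truth"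
  by (simp add: monic_iff_inj sheaf_One sheaf_Omega truth_hom inj_on_def)

text \<open>The bounds on \<open>m\<close> force \<open>m\<^sup>- = u\<^sup>-\<close>, so
  restricting to \<open>m\<close> multiplies by \<open>u\<^sup>-\<close> and leaves a section over
  \<open>u\<close> unchanged.\<close>

lemma dense_truth: "dense One Omega truth"
  unfolding dense_def
proof (intro conjI truth_hom allI ballI iffI)
  fix u y :: 'a assume y: "y \<in> sec Omega u"
  assume "\<exists>m. u\<^sup>- \<le> m \<and> m \<le> u \<and> res Omega u m y \<in> truth m ` sec One m"
  then obtain m where m: "u\<^sup>- \<le> m" "m \<le> u" "y * m\<^sup>- = m\<^sup>-"
    by (auto simp: res_Omega truth_def)
  have "m\<^sup>- = u\<^sup>-"
    using m(1,2) qminus_mono by (metis Idem_le_qminus_iff order.antisym qminus_Idem)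
  then have "y = u\<^sup>-" using m(3) y by (simp add: sec_Omega)
  then show "y \<in> truth u ` sec One u" by (auto simp: truth_def One_def)
next
  fix u y :: 'a assume y: "y \<in> sec Omega u" "y \<in> truth u ` sec One u"
  then have "res Omega u u y \<in> truth u ` sec One u"
    by (simp only: is_presheaf_res_id[OF is_presheaf_Omega y(1)])
  then show "\<exists>m. u\<^sup>- \<le> m \<and> m \<le> u \<and> res Omega u m y \<in> truth m ` sec One m"
    using qminus_le by blast
qed


section \<open>The characteristic morphism\<close>

text \<open>Joining the \<open>v\<^sup>-\<close> rather than the \<open>v\<close> makes each value
  an idempotent below \<open>u\<^sup>-\<close>, hence a section of \<open>Omega\<close> fixed by
  \<open>qminus\<close>.\<close>

definition char_mor :: "('q::comm_semicartesian_quantale, 's) presheaf \<Rightarrow> ('q, 'a) presheaf \<Rightarrow>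
    ('q \<Rightarrow> 's \<Rightarrow> 'a) \<Rightarrow> ('q \<Rightarrow> 'a \<Rightarrow> 'q)" where
  "char_mor S F m =
     (\<lambda>u. \<lambda>y\<in>sec F u. SUP v\<in>{v. v \<le> u \<and> res F u v y \<in> m v ` sec S v}. v\<^sup>-)"

lemma image_res:
  assumes "is_presheaf S" "m \<in> hom S F" "y \<in> m u ` sec S u" "v \<le> u"
  shows "res F u v y \<in> m v ` sec S v"
  using assms by (auto simp: hom_natural is_presheaf_res)

lemma char_mor_Idem: "y \<in> sec F u \<Longrightarrow> char_mor S F m u y \<in> Idem"
  by (auto simp: char_mor_def qminus_Idem intro!: Sup_Idem)

lemma char_mor_le:
  assumes "y \<in> sec F u"
  shows "char_mor S F m u y \<le> u\<^sup>-"
  using assms by (auto simp: char_mor_def intro!: SUP_least qminus_mono)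

lemma qminus_le_char_mor:
  assumes "y \<in> sec F u" "v \<le> u" "res F u v y \<in> m v ` sec S v"
  shows "v\<^sup>- \<le> char_mor S F m u y"
  using assms by (auto simp: char_mor_def intro!: SUP_upper)

text \<open>For naturality, multiplying by \<open>v\<^sup>-\<close> replaces each index
  \<open>w\<close> by \<open>w * v\<close>, where the restriction still lies in the image.
  Conversely, an index \<open>w \<le> v\<close> satisfies
  \<open>w\<^sup>- * v\<^sup>- = w\<^sup>-\<close>, so it loses nothing under that
  multiplication.\<close>

lemma char_mor_hom:
  assumes S: "is_presheaf S" and F: "is_presheaf F" and m: "m \<in> hom S F"
  shows "char_mor S F m \<in> hom F Omega"
  unfolding hom_def
proof (intro CollectI conjI allI impI ballI)
  fix u
  have "char_mor S F m u y * u\<^sup>- = char_mor S F m u y" if "y \<in> sec F u" for y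
    using char_mor_Idem[OF that] char_mor_le[OF that] by (metis mult_Idem_eq_iff mult.commute)
  then show "char_mor S F m u \<in> sec F u \<rightarrow>\<^sub>E sec Omega u"
    by (auto simp: sec_Omega char_mor_def)
next
  fix u v y assume v: "v \<le> u" and y: "y \<in> sec F u"
  let ?W = "{w. w \<le> u \<and> res F u w y \<in> m w ` sec S w}"
  have y': "res F u v y \<in> sec F v" using F y v by (rule is_presheaf_res)
  have eq: "char_mor S F m u y * v\<^sup>- = (SUP w\<in>?W. (w * v)\<^sup>-)"
    using y by (simp add: char_mor_def Sup_mult image_image qminus_mult)
  have "(w * v)\<^sup>- \<le> char_mor S F m v (res F u v y)" if w: "w \<in> ?W" for w
  proof (rule qminus_le_char_mor[OF y' mult_le_right])
    have "res F w (w * v) (res F u w y) \<in> m (w * v) ` sec S (w * v)"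
      using w by (intro image_res[where F = F, OF S m _ mult_le_left]) simp
    then show "res F v (w * v) (res F u v y) \<in> m (w * v) ` sec S (w * v)"
      using w by (simp add: is_presheaf_res_res[OF F y] v mult_le_left mult_le_right)
  qed
  then have 1: "char_mor S F m u y * v\<^sup>- \<le> char_mor S F m v (res F u v y)"
    unfolding eq by (rule SUP_least)
  have "w\<^sup>- \<le> char_mor S F m u y * v\<^sup>-"
    if w: "w \<le> v" "res F v w (res F u v y) \<in> m w ` sec S w" for w
  proof -
    have "w\<^sup>- \<le> char_mor S F m u y"
      using w v by (intro qminus_le_char_mor[OF y]) (auto simp: is_presheaf_res_res[OF F y])
    then have "w\<^sup>- * v\<^sup>- \<le> char_mor S F m u y * v\<^sup>-" by (intro mult_mono_quantale) auto
    then show ?thesis using qminus_absorb[OF w(1)] by (simp add: mult.commute)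
  qed
  then have 2: "char_mor S F m v (res F u v y) \<le> char_mor S F m u y * v\<^sup>-"
    using y' by (auto simp: char_mor_def[of S F m] intro!: SUP_least)
  show "res Omega u v (char_mor S F m u y) = char_mor S F m v (res F u v y)"
    unfolding res_Omega using 1 2 by (rule order.antisym)
qed

section \<open>Gluing inside a subsheaf\<close>

text \<open>Injectivity on the overlaps makes the local preimages compatible, so they glue in
  \<open>S\<close>. Uniqueness of gluing in \<open>F\<close> then identifies the image of the glued
  section with \<open>y\<close>.\<close>

lemma image_local:
  fixes F :: "('q::comm_semicartesian_quantale, 'a) presheaf"
  assumes S: "sheaf S" and F: "sheaf F" and m: "m \<in> hom S F"
    and inj: "\<And>v. inj_on (m v) (sec S v)" and y: "y \<in> sec F u"
    and u: "u = (SUP i\<in>I. U i)" and loc: "\<And>i. i \<in> I \<Longrightarrow> res F u (U i) y \<in> m (U i) ` sec S (U i)"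
  shows "y \<in> m u ` sec S u"
proof -
  have S': "is_presheaf S" and F': "is_presheaf F" using S F by (auto simp: sheaf_def)
  have "\<forall>i\<in>I. \<exists>x. x \<in> sec S (U i) \<and> m (U i) x = res F u (U i) y" using loc by force
  then obtain s where s: "s i \<in> sec S (U i)" "m (U i) (s i) = res F u (U i) y"
    if "i \<in> I" for i by metis
  have le: "U i \<le> u" if "i \<in> I" for i using that unfolding u by (rule SUP_upper)
  have m_res: "m v (res S (U i) v (s i)) = res F u v y" if "i \<in> I" "v \<le> U i" for i v
    using hom_natural[OF m s(1)[OF that(1)] that(2)] s(2)[OF that(1)] that
    by (simp add: is_presheaf_res_res[OF F' y] le)
  have "\<exists>!t. t \<in> sec S u \<and> (\<forall>i\<in>I. res S u (U i) t = s i)"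
  proof (rule sheaf_glue[OF S u s(1)])
    fix i j assume i: "i \<in> I" and j: "j \<in> I"
    show "res S (U i) (U i * U j) (s i) = res S (U j) (U i * U j) (s j)"
      using i j by (intro inj_onD[OF inj[of "U i * U j"]])
        (auto simp: m_res mult_le_left mult_le_right intro!: is_presheaf_res[OF S'] s(1))
  qed
  then obtain t where t: "t \<in> sec S u" "\<And>i. i \<in> I \<Longrightarrow> res S u (U i) t = s i" by blast
  have "\<exists>!z. z \<in> sec F u \<and> (\<forall>i\<in>I. res F u (U i) z = res F u (U i) y)"
    by (rule sheaf_glue[OF F u])
      (auto simp: is_presheaf_res[OF F' y] le is_presheaf_res_res[OF F' y] mult_le_left mult_le_right)
  moreover have "m u t \<in> sec F u" using m t(1) by (rule hom_closed)
  moreover have "res F u (U i) (m u t) = res F u (U i) y" if "i \<in> I" for i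
    using hom_natural[OF m t(1) le[OF that]] t(2) s(2) that by simp
  ultimately have "m u t = y" using y by (elim ex1_uniq) auto
  then show ?thesis using t(1) by blast
qed

lemma char_mor_eq_iff:
  assumes S: "sheaf S" and F: "sheaf F" and m: "dense S F m"
    and inj: "\<And>v. inj_on (m v) (sec S v)" and y: "y \<in> sec F u"
  shows "char_mor S F m u y = u\<^sup>- \<longleftrightarrow> y \<in> m u ` sec S u"
proof
  have S': "is_presheaf S" and F': "is_presheaf F" using S F by (auto simp: sheaf_def)
  have m': "m \<in> hom S F" using m by (simp add: dense_def)
  let ?W = "{w. w \<le> u \<and> res F u w y \<in> m w ` sec S w}"
  show "char_mor S F m u y = u\<^sup>-" if "y \<in> m u ` sec S u"
    using that char_mor_le[OF y, of S m] qminus_le_char_mor[OF y order_refl, of m S]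
    by (intro order.antisym) (simp_all only: is_presheaf_res_id[OF F' y])
  assume "char_mor S F m u y = u\<^sup>-"
  then have "u\<^sup>- = (SUP w\<in>?W. w\<^sup>-)" using y by (simp add: char_mor_def)
  \<comment> \<open>The opens \<open>w\<^sup>-\<close> cover only \<open>u\<^sup>-\<close>, so
    gluing reaches the restriction of \<open>y\<close> to \<open>u\<^sup>-\<close>.\<close>
  then have "res F u (u\<^sup>-) y \<in> m (u\<^sup>-) ` sec S (u\<^sup>-)"
  proof (rule image_local[OF S F m' inj is_presheaf_res[OF F' y qminus_le]])
    fix w assume w: "w \<in> ?W"
    then have "res F w (w\<^sup>-) (res F u w y) \<in> m (w\<^sup>-) ` sec S (w\<^sup>-)"
      by (intro image_res[where F = F, OF S' m' _ qminus_le]) simp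
    then show "res F (u\<^sup>-) (w\<^sup>-) (res F u (u\<^sup>-) y) \<in> m (w\<^sup>-) ` sec S (w\<^sup>-)"
      using w by (simp add: is_presheaf_res_res[OF F' y] qminus_le qminus_mono)
  qed
  \<comment> \<open>Density is applied with the intermediate open \<open>u\<^sup>-\<close>.\<close>
  then show "y \<in> m u ` sec S u"
    using m y order_refl[of "u\<^sup>-"] qminus_le[of u] unfolding dense_def by blast
qed

lemma nminus_char_mor:
  assumes "char_mor S F m \<in> hom F Omega"
  shows "nminus F (char_mor S F m) = char_mor S F m"
proof (intro ext)
  fix u y show "nminus F (char_mor S F m) u y = char_mor S F m u y"
  proof (cases "y \<in> sec F u")
    case True
    then show ?thesis using hom_closed[OF assms True]
      by (simp add: nminus_def ncomp_apply Omega_minus_def qminus_of_Idem char_mor_Idem)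
  next
    case False
    then show ?thesis by (simp add: nminus_def ncomp_def compose_def char_mor_def)
  qed
qed

section \<open>Pullback squares over \<open>truth\<close>\<close>

text \<open>Since \<open>One\<close> has a single section over each open, the pointwise universal
  property asks just for a unique preimage of \<open>y\<close>, and injectivity supplies uniqueness.
  Commutativity of the square is the implication from right to left in the pointwise
  equivalence.\<close>

lemma pullback_truth_iff:
  fixes F :: "('q::geometric_quantale, 'a) presheaf" and S :: "('q, 's) presheaf"
  assumes S: "sheaf S" and F: "sheaf F" and m: "m \<in> hom S F"
    and inj: "\<And>v. inj_on (m v) (sec S v)" and \<phi>: "\<phi> \<in> hom F Omega"
  shows "pullback TYPE('t) S F One Omega m (bang S) \<phi> truth \<longleftrightarrow>
    (\<forall>u. \<forall>y\<in>sec F u. \<phi> u y = u\<^sup>- \<longleftrightarrow> y \<in> m u ` sec S u)"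
proof -
  have S': "is_presheaf S" using S by (simp add: sheaf_def)
  have bang: "bang S \<in> hom S One"
    using S' by (auto simp: hom_def bang_def One_def is_presheaf_res)
  have comm: "ncomp S \<phi> m = ncomp S truth (bang S) \<longleftrightarrow> (\<forall>u. \<forall>s\<in>sec S u. \<phi> u (m u s) = u\<^sup>-)"
  proof
    assume eq: "ncomp S \<phi> m = ncomp S truth (bang S)"
    show "\<forall>u. \<forall>s\<in>sec S u. \<phi> u (m u s) = u\<^sup>-"
    proof (intro allI ballI)
      fix u s assume s: "s \<in> sec S u"
      show "\<phi> u (m u s) = u\<^sup>-"
        using ncomp_apply[OF s, of \<phi> m] ncomp_apply[OF s, of truth "bang S"] eq
        by (simp add: truth_def)
    qed
  next
    assume "\<forall>u. \<forall>s\<in>sec S u. \<phi> u (m u s) = u\<^sup>-"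
    then show "ncomp S \<phi> m = ncomp S truth (bang S)"
      by (intro hom_eqI[OF hom_ncomp[OF m \<phi> S'] hom_ncomp[OF bang truth_hom S']])
        (simp add: ncomp_apply truth_def)
  qed
  have univ: "(\<exists>!s. s \<in> sec S u \<and> m u s = y \<and> bang S u s = z) \<longleftrightarrow> y \<in> m u ` sec S u" for u y z
    using inj[of u] by (auto simp: inj_on_def)
  have sec_One: "sec One u = UNIV" for u :: 'q by (auto simp: One_def)
  show ?thesis
    unfolding pullback_iff_pointwise comm univ
    using assms bang sheaf_One sheaf_Omega truth_hom hom_closed[OF m]
    by (auto simp: truth_def sec_One)
qed

text \<open>The right-hand side does not mention \<open>\<phi>\<close>, which yields both uniqueness
  claims. By naturality \<open>\<phi>\<close> sends the restriction of \<open>y\<close> to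
  \<open>?q * v\<^sup>-\<close>, and this equals \<open>v\<^sup>-\<close> exactly when
  \<open>v\<^sup>- \<le> ?q\<close>.\<close>

lemma nminus_eq_char_mor:
  assumes F: "is_presheaf F" and \<phi>: "\<phi> \<in> hom F Omega"
    and iff: "\<And>u y. y \<in> sec F u \<Longrightarrow> \<phi> u y = u\<^sup>- \<longleftrightarrow> y \<in> m u ` sec S u"
  shows "nminus F \<phi> = char_mor S F m"
proof (intro ext)
  fix u y show "nminus F \<phi> u y = char_mor S F m u y"
  proof (cases "y \<in> sec F u")
    case True
    let ?q = "\<phi> u y"
    have q: "?q \<in> sec Omega u" using \<phi> True by (rule hom_closed)
    \<comment> \<open>This bound makes \<open>?q\<^sup>-\<close> an admissible index of the join
      below, where it attains the value.\<close>
    then have "?q \<le> u" by (metis sec_Omega mult_le_right qminus_le order_trans)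
    then have q_le: "?q\<^sup>- \<le> u" using qminus_le order_trans by blast
    have "res F u v y \<in> m v ` sec S v \<longleftrightarrow> v\<^sup>- \<le> ?q" if "v \<le> u" for v
      using iff[OF is_presheaf_res[OF F True that]]
      by (simp add: res_Omega mult_Idem_eq_iff qminus_Idem flip: hom_natural[OF \<phi> True that])
    then have "char_mor S F m u y = (SUP v\<in>{v. v \<le> u \<and> v\<^sup>- \<le> ?q}. v\<^sup>-)"
      using True by (simp add: char_mor_def cong: conj_cong)
    also have "\<dots> = ?q\<^sup>-"
    proof (rule order.antisym)
      show "(SUP v\<in>{v. v \<le> u \<and> v\<^sup>- \<le> ?q}. v\<^sup>-) \<le> ?q\<^sup>-"
        by (rule SUP_least) (simp add: Idem_le_qminus_iff qminus_Idem)
      have "(?q\<^sup>-)\<^sup>- = ?q\<^sup>-" by (rule qminus_of_Idem[OF qminus_Idem])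
      then show "?q\<^sup>- \<le> (SUP v\<in>{v. v \<le> u \<and> v\<^sup>- \<le> ?q}. v\<^sup>-)"
        using q_le qminus_le[of ?q] by (intro SUP_upper2[of "?q\<^sup>-"]) auto
    qed
    finally show ?thesis using q True by (simp add: nminus_def ncomp_apply Omega_minus_def)
  next
    case False
    then show ?thesis by (simp add: nminus_def ncomp_def compose_def char_mor_def)
  qed
qed

theorem theorem5p6:
  shows
    "(monic TYPE('t) (One :: ('q::geometric_quantale, unit) presheaf) Omega truth \<and>
      dense (One :: ('q, unit) presheaf) Omega truth) \<and>
     (\<forall>(S :: ('q, 's) presheaf) (F :: ('q, 'a) presheaf) m.
        monic TYPE('t) S F m \<and> dense S F m \<longrightarrow>
        (\<exists>!\<chi>. \<chi> \<in> hom F Omega \<and> nminus F \<chi> = \<chi> \<and>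
           pullback TYPE('t) S F One Omega m (bang S) \<chi> truth) \<and>
        (\<forall>\<phi>\<in>hom F Omega. \<forall>\<phi>'\<in>hom F Omega.
           pullback TYPE('t) S F One Omega m (bang S) \<phi> truth \<longrightarrow>
           pullback TYPE('t) S F One Omega m (bang S) \<phi>' truth \<longrightarrow>
           nminus F \<phi> = nminus F \<phi>'))"
proof (intro conjI allI impI)
  show "monic TYPE('t) (One :: ('q, unit) presheaf) Omega truth" by (rule monic_truth)
  show "dense (One :: ('q, unit) presheaf) Omega truth" by (rule dense_truth)
next
  fix S :: "('q, 's) presheaf" and F :: "('q, 'a) presheaf" and m
  assume "monic TYPE('t) S F m \<and> dense S F m"
  then have S: "sheaf S" and F: "sheaf F" and m: "m \<in> hom S F" and d: "dense S F m"
    and inj: "\<And>v. inj_on (m v) (sec S v)"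
    by (auto simp: monic_iff_inj)
  have S': "is_presheaf S" and F': "is_presheaf F" using S F by (auto simp: sheaf_def)
  let ?P = "\<lambda>\<phi>. pullback TYPE('t) S F One Omega m (bang S) \<phi> truth"
  have uniq: "nminus F \<phi> = char_mor S F m" if "\<phi> \<in> hom F Omega" "?P \<phi>" for \<phi>
    using that pullback_truth_iff[OF S F m inj that(1)] by (intro nminus_eq_char_mor F') auto
  have \<chi>: "char_mor S F m \<in> hom F Omega" by (rule char_mor_hom[OF S' F' m])
  have "?P (char_mor S F m)"
    using char_mor_eq_iff[OF S F d inj] by (simp add: pullback_truth_iff[OF S F m inj \<chi>])
  \<comment> \<open>A competitor fixed by \<open>nminus\<close> equals its own
    \<open>nminus\<close>, which \<open>uniq\<close> identifies with
    \<open>char_mor S F m\<close>.\<close>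
  then show "\<exists>!\<chi>. \<chi> \<in> hom F Omega \<and> nminus F \<chi> = \<chi> \<and> ?P \<chi>"
    using \<chi> nminus_char_mor[OF \<chi>] uniq by (intro ex1I[of _ "char_mor S F m"]) auto
  show "\<forall>\<phi>\<in>hom F Omega. \<forall>\<phi>'\<in>hom F Omega. ?P \<phi> \<longrightarrow> ?P \<phi>' \<longrightarrow> nminus F \<phi> = nminus F \<phi>'"
    using uniq by simp
qed

end
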